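(* Let $G$ be a primitive permutation group on a finite set $\Omega$ of size $n$. Then $G$ synchronizes every transformation $f:\Omega\to\Omega$ of rank $n-3$ or $n-4$.
   Context: A permutation group $G$ on $\Omega$ is primitive if it is transitive and preserves no equivalence relation on $\Omega$ other than equality and the universal relation. The rank of a map is the size of its image. $G$ synchronizes $f$ if the transformation semigroup $\langle G,f\rangle$ contains a constant map. *)

theory Defs
  imports "HOL-Algebra.Group_Action"
begin

text \<open>
  Permutations and transformations of a set \<open>\<Omega>\<close> are extensional functions, as in \<^const>\<open>BijGroup\<close>.
\<close>

definition permutation_group :: "'a set \<Rightarrow> ('a \<Rightarrow> 'a) set \<Rightarrow> bool"
  where "permutation_group \<Omega> G \<longleftrightarrow> subgroup G (BijGroup \<Omega>)"

definition transitive_group :: "'a set \<Rightarrow> ('a \<Rightarrow> 'a) set \<Rightarrow> bool"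
  where "transitive_group \<Omega> G \<longleftrightarrow>
    transitive_action ((BijGroup \<Omega>)\<lparr>carrier := G\<rparr>) \<Omega> (\<lambda>g. g)"

definition preserves :: "('a \<Rightarrow> 'a) set \<Rightarrow> ('a \<times> 'a) set \<Rightarrow> bool"
  where "preserves G r \<longleftrightarrow> (\<forall>g\<in>G. \<forall>(x, y)\<in>r. (g x, g y) \<in> r)"

definition primitive_group :: "'a set \<Rightarrow> ('a \<Rightarrow> 'a) set \<Rightarrow> bool"
  where "primitive_group \<Omega> G \<longleftrightarrow>
    permutation_group \<Omega> G \<and> transitive_group \<Omega> G \<and>
    (\<forall>r. equiv \<Omega> r \<and> preserves G r \<longrightarrow> r = Id_on \<Omega> \<or> r = \<Omega> \<times> \<Omega>)"

definition rank :: "'a set \<Rightarrow> ('a \<Rightarrow> 'a) \<Rightarrow> nat"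
  where "rank \<Omega> f = card (f ` \<Omega>)"

inductive_set transformation_semigroup :: "'a set \<Rightarrow> ('a \<Rightarrow> 'a) set \<Rightarrow> ('a \<Rightarrow> 'a) set"
  for \<Omega> :: "'a set" and S :: "('a \<Rightarrow> 'a) set"
  where
    generator: "h \<in> S \<Longrightarrow> h \<in> transformation_semigroup \<Omega> S"
  | product: "h \<in> transformation_semigroup \<Omega> S \<Longrightarrow> k \<in> transformation_semigroup \<Omega> S \<Longrightarrow>
      compose \<Omega> h k \<in> transformation_semigroup \<Omega> S"

definition constant_map :: "'a set \<Rightarrow> ('a \<Rightarrow> 'a) \<Rightarrow> bool"
  where "constant_map \<Omega> h \<longleftrightarrow> (\<exists>c\<in>\<Omega>. \<forall>x\<in>\<Omega>. h x = c)"

definition synchronizes :: "'a set \<Rightarrow> ('a \<Rightarrow> 'a) set \<Rightarrow> ('a \<Rightarrow> 'a) \<Rightarrow> bool"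
  where "synchronizes \<Omega> G f \<longleftrightarrow>
    (\<exists>h\<in>transformation_semigroup \<Omega> (insert f G). constant_map \<Omega> h)"

end

theory Submission
  imports Defs "HOL-Library.Numeral_Type"
begin

text \<open>
  Suppose the semigroup \<open>\<langle>G, f\<rangle>\<close> has minimal rank \<open>r > 1\<close>. Let \<open>\<K>\<close> be the set of images and \<open>\<S>\<close> the set of
  kernel classes of its elements of rank \<open>r\<close>. Every \<open>K \<in> \<K>\<close> meets every \<open>S \<in> \<S>\<close> in exactly one point,
  images under \<open>f\<close> preserve \<open>\<K>\<close>, preimages under \<open>f\<close> preserve \<open>\<S>\<close>, and by primitivity both families
  separate points.

  Preimage under \<open>f\<close> cannot be injective on \<open>\<S>\<close>, and two members of \<open>\<S>\<close> with the same preimage differ by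
  exchanging two points \<open>P\<close> for two points \<open>N\<close> outside the image of \<open>f\<close> (exchanging one point is
  impossible). So the defect is at least 4. If it is 4, then on the span of the indicator functions
  of \<open>\<S>\<close> over the field with three elements, pulling back along \<open>f\<close> has kernel spanned by
  \<open>1\<^sub>P - 1\<^sub>N\<close>, hence image of codimension one; therefore an element of the span that is constant on one
  nontrivial kernel class of \<open>f\<close> is constant on all of them. Applied to the translates of \<open>1\<^sub>P - 1\<^sub>N\<close>,
  this bounds by two the degree of the \<open>G\<close>-invariant graph generated by the pairs that \<open>f\<close> collapses.
  Applied to \<open>\<S>\<close>, it then shows that the connected components of this graph have at most four points,
  contradicting primitivity.
\<close>

section \<open>Primitive permutation groups\<close>

locale primitive_permutations =
  fixes \<Omega> :: "'a set" and G :: "('a \<Rightarrow> 'a) set"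
  assumes finite_points: "finite \<Omega>"
    and primitive: "primitive_group \<Omega> G"
begin

lemma subgroup_G: "subgroup G (BijGroup \<Omega>)"
  using primitive by (simp add: primitive_group_def permutation_group_def)

lemma G_Bij: "g \<in> G \<Longrightarrow> g \<in> Bij \<Omega>"
  using subgroup.subset[OF subgroup_G] by (auto simp: BijGroup_def)

lemma G_bij_betw: "g \<in> G \<Longrightarrow> bij_betw g \<Omega> \<Omega>"
  using G_Bij by (auto simp: Bij_def)

lemma G_closed: "g \<in> G \<Longrightarrow> x \<in> \<Omega> \<Longrightarrow> g x \<in> \<Omega>"
  using G_bij_betw bij_betwE by blast

lemma G_inverse:
  assumes "g \<in> G"
  obtains h where "h \<in> G" "\<And>x. x \<in> \<Omega> \<Longrightarrow> h (g x) = x" "\<And>x. x \<in> \<Omega> \<Longrightarrow> g (h x) = x"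
proof
  let ?h = "\<lambda>x\<in>\<Omega>. inv_into \<Omega> g x"
  show "?h \<in> G"
    using subgroup.m_inv_closed[OF subgroup_G assms] inv_BijGroup[OF G_Bij[OF assms]] by simp
  show "?h (g x) = x" if "x \<in> \<Omega>" for x
    using that G_bij_betw[OF assms] G_closed[OF assms] by (simp add: bij_betw_inv_into_left)
  show "g (?h x) = x" if "x \<in> \<Omega>" for x
    using that G_bij_betw[OF assms] by (simp add: bij_betw_inv_into_right)
qed

lemma transitive:
  assumes "x \<in> \<Omega>" "y \<in> \<Omega>"
  obtains g where "g \<in> G" "g x = y"
proof -
  have "transitive_action ((BijGroup \<Omega>)\<lparr>carrier := G\<rparr>) \<Omega> (\<lambda>g. g)"
    using primitive by (simp add: primitive_group_def transitive_group_def)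
  from transitive_action.unique_orbit[OF this assms] that show ?thesis by auto
qed

lemma G_eq_iff: "g \<in> G \<Longrightarrow> x \<in> \<Omega> \<Longrightarrow> y \<in> \<Omega> \<Longrightarrow> g x = g y \<longleftrightarrow> x = y"
  using G_bij_betw[of g] by (auto simp: bij_betw_def inj_on_eq_iff)

lemma G_image: "g \<in> G \<Longrightarrow> g ` \<Omega> = \<Omega>"
  using G_bij_betw by (auto simp: bij_betw_def)

lemma no_invariant_equivalence:
  assumes "equiv \<Omega> r" "preserves G r"
  shows "r = Id_on \<Omega> \<or> r = \<Omega> \<times> \<Omega>"
  by (rule primitive[unfolded primitive_group_def, THEN conjunct2, THEN conjunct2, rule_format])
    (use assms in simp)

text \<open>The reflexive transitive closure of \<open>r\<close> on \<Omega> is an invariant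
  equivalence, and \<open>(a, b)\<close> makes it differ from equality. By primitivity the graph
  \<open>r\<close> is connected.\<close>

lemma closed_set_eq_all:
  assumes r: "r \<subseteq> \<Omega> \<times> \<Omega>" "sym r" "preserves G r"
    and ab: "(a, b) \<in> r" "a \<noteq> b"
    and C: "C \<subseteq> \<Omega>" "x \<in> C" "\<And>u v. u \<in> C \<Longrightarrow> (u, v) \<in> r \<Longrightarrow> v \<in> C"
  shows "C = \<Omega>"
proof -
  let ?R = "r\<^sup>* \<inter> \<Omega> \<times> \<Omega>"
  have "equiv \<Omega> ?R"
  proof (rule equivI)
    show "refl_on \<Omega> ?R" by (auto intro: refl_onI)
    show "sym ?R" using sym_rtrancl[OF r(2)] by (auto simp: sym_def)
    show "trans ?R" by (auto simp: trans_def)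
  qed auto
  moreover have "preserves G ?R"
    unfolding preserves_def
  proof (intro ballI, clarsimp)
    fix g u v assume g: "g \<in> G" and uv: "(u, v) \<in> r\<^sup>*" and "u \<in> \<Omega>" "v \<in> \<Omega>"
    from uv have "(g u, g v) \<in> r\<^sup>*"
    proof (induction rule: rtrancl_induct)
      case (step y z)
      then have "(g y, g z) \<in> r" using r(3) g by (auto simp: preserves_def)
      with step.IH show ?case by simp
    qed simp
    then show "(g u, g v) \<in> r\<^sup>* \<and> g u \<in> \<Omega> \<and> g v \<in> \<Omega>"
      using g \<open>u \<in> \<Omega>\<close> \<open>v \<in> \<Omega>\<close> G_closed by auto
  qed
  moreover have "(a, b) \<in> ?R" using ab r(1) by blast
  then have "?R \<noteq> Id_on \<Omega>" using ab(2) by (metis Id_on_iff)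
  ultimately have R: "?R = \<Omega> \<times> \<Omega>" using no_invariant_equivalence by blast
  have "y \<in> C" if "(x, y) \<in> r\<^sup>*" for y
    using that by (induction rule: rtrancl_induct) (use C in auto)
  then show ?thesis using R C by blast
qed

lemma card_members_eq:
  assumes F: "\<And>A. A \<in> F \<Longrightarrow> A \<subseteq> \<Omega>" "\<And>g A. g \<in> G \<Longrightarrow> A \<in> F \<Longrightarrow> g ` A \<in> F"
    and xy: "x \<in> \<Omega>" "y \<in> \<Omega>"
  shows "card {A \<in> F. x \<in> A} = card {A \<in> F. y \<in> A}"
proof -
  have fin: "finite {A \<in> F. z \<in> A}" for z
    by (rule finite_subset[of _ "Pow \<Omega>"]) (use F finite_points in auto)
  have le: "card {A \<in> F. u \<in> A} \<le> card {A \<in> F. v \<in> A}" if uv: "u \<in> \<Omega>" "v \<in> \<Omega>" for u v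
  proof -
    obtain g where g: "g \<in> G" "g u = v" using transitive[OF uv] .
    have "inj_on (image g) {A \<in> F. u \<in> A}"
    proof (rule inj_on_subset)
      show "inj_on (image g) (Pow \<Omega>)"
        using G_bij_betw[OF g(1)] by (intro inj_on_image_Pow) (simp add: bij_betw_def)
    qed (use F in auto)
    moreover have "image g ` {A \<in> F. u \<in> A} \<subseteq> {A \<in> F. v \<in> A}" using F g by auto
    ultimately show ?thesis using fin by (rule card_inj_on_le)
  qed
  show ?thesis using le[OF xy] le[OF xy(2,1)] by simp
qed

text \<open>
  Every point lies in equally many members, so the preorder "every member containing \<open>x\<close> contains
  \<open>y\<close>" is symmetric, hence an invariant equivalence relation.
\<close>

lemma separating_member:
  assumes F: "\<And>A. A \<in> F \<Longrightarrow> A \<subseteq> \<Omega>" "\<And>g A. g \<in> G \<Longrightarrow> A \<in> F \<Longrightarrow> g ` A \<in> F"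
    and A: "A \<in> F" "A \<noteq> {}" "A \<noteq> \<Omega>"
    and xy: "x \<in> \<Omega>" "y \<in> \<Omega>" "x \<noteq> y"
  obtains B where "B \<in> F" "x \<in> B" "y \<notin> B"
proof -
  let ?r = "{(u, v). u \<in> \<Omega> \<and> v \<in> \<Omega> \<and> {B \<in> F. u \<in> B} = {B \<in> F. v \<in> B}}"
  have fin: "finite {B \<in> F. z \<in> B}" for z
    by (rule finite_subset[of _ "Pow \<Omega>"]) (use F finite_points in auto)
  have "equiv \<Omega> ?r"
    by (rule equivI) (auto simp: refl_on_def sym_def trans_def)
  moreover have "preserves G ?r"
  proof -
    have "{B \<in> F. g u \<in> B} \<subseteq> {B \<in> F. g v \<in> B}"
      if g: "g \<in> G" and uv: "u \<in> \<Omega>" "v \<in> \<Omega>" "{B \<in> F. u \<in> B} = {B \<in> F. v \<in> B}" for g u v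
    proof clarify
      fix B assume B: "B \<in> F" "g u \<in> B"
      obtain h where h: "h \<in> G" "\<And>x. x \<in> \<Omega> \<Longrightarrow> h (g x) = x" "\<And>x. x \<in> \<Omega> \<Longrightarrow> g (h x) = x"
        using G_inverse[OF g] by blast
      have "u \<in> h ` B" using B h(2)[OF uv(1)] by force
      then have "v \<in> h ` B" using F(2)[OF h(1) B(1)] uv(3) by blast
      then obtain b where "b \<in> B" "v = h b" by blast
      then show "g v \<in> B" using h(3) F(1)[OF B(1)] by auto
    qed
    then have "{B \<in> F. g u \<in> B} = {B \<in> F. g v \<in> B}"
      if "g \<in> G" "u \<in> \<Omega>" "v \<in> \<Omega>" "{B \<in> F. u \<in> B} = {B \<in> F. v \<in> B}" for g u v
      using that by (intro subset_antisym) auto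
    then show ?thesis by (auto simp: preserves_def G_closed)
  qed
  moreover have "?r \<noteq> \<Omega> \<times> \<Omega>"
  proof
    assume eq: "?r = \<Omega> \<times> \<Omega>"
    obtain a where a: "a \<in> A" using A by auto
    have "\<Omega> \<subseteq> A"
    proof
      fix z assume "z \<in> \<Omega>"
      then have "(a, z) \<in> ?r" using eq a F(1)[OF A(1)] by blast
      then show "z \<in> A" using a A(1) by blast
    qed
    then show False using A F by blast
  qed
  ultimately have r: "?r = Id_on \<Omega>" using no_invariant_equivalence by blast
  show thesis
  proof (rule ccontr)
    assume "\<not> thesis"
    then have sub: "{B \<in> F. x \<in> B} \<subseteq> {B \<in> F. y \<in> B}" using that by blast
    then have "{B \<in> F. x \<in> B} = {B \<in> F. y \<in> B}"
      using card_members_eq[OF F xy(1,2)] fin by (intro card_subset_eq) auto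
    then have "(x, y) \<in> ?r" using xy by auto
    then show False using r xy by auto
  qed
qed

end

lemma three_cases: "c = 0 \<or> c = 1 \<or> c = 2" for c :: 3
proof (cases c rule: bit1_cases)
  case (of_int z)
  then have "z = 0 \<or> z = 1 \<or> z = 2" by auto
  with of_int show ?thesis by auto
qed

lemma three_exhaust [case_names zero one two]:
  fixes c :: 3
  obtains "c = 0" | "c = 1" | "c = 2"
  using three_cases by blast

section \<open>Mutually transversal families\<close>

locale transversal_families = primitive_permutations +
  fixes \<K> \<S> :: "'a set set"
  assumes K_subset: "K \<in> \<K> \<Longrightarrow> K \<subseteq> \<Omega>"
    and S_subset: "S \<in> \<S> \<Longrightarrow> S \<subseteq> \<Omega>"
    and K_proper: "K \<in> \<K> \<Longrightarrow> K \<noteq> \<Omega>"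
    and S_proper: "S \<in> \<S> \<Longrightarrow> S \<noteq> \<Omega>"
    and K_ex: "\<K> \<noteq> {}"
    and S_ex: "\<S> \<noteq> {}"
    and transversal: "K \<in> \<K> \<Longrightarrow> S \<in> \<S> \<Longrightarrow> \<exists>!x. x \<in> K \<and> x \<in> S"
    and G_K: "g \<in> G \<Longrightarrow> K \<in> \<K> \<Longrightarrow> g ` K \<in> \<K>"
    and G_S: "g \<in> G \<Longrightarrow> S \<in> \<S> \<Longrightarrow> g -` S \<inter> \<Omega> \<in> \<S>"
begin

lemma G_image_S:
  assumes "g \<in> G" "S \<in> \<S>"
  shows "g ` S \<in> \<S>"
proof -
  obtain h where h: "h \<in> G" "\<And>x. x \<in> \<Omega> \<Longrightarrow> h (g x) = x" "\<And>x. x \<in> \<Omega> \<Longrightarrow> g (h x) = x"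
    using G_inverse[OF assms(1)] by blast
  have "g ` S = h -` S \<inter> \<Omega>"
  proof (intro subset_antisym subsetI)
    fix z assume "z \<in> g ` S"
    then show "z \<in> h -` S \<inter> \<Omega>"
      using S_subset[OF assms(2)] h(2) G_closed[OF assms(1)] by auto
  next
    fix z assume "z \<in> h -` S \<inter> \<Omega>"
    then show "z \<in> g ` S" using h(3)[of z] by force
  qed
  then show ?thesis using G_S[OF h(1) assms(2)] by simp
qed

lemma finite_K: "finite \<K>"
  by (rule finite_subset[of _ "Pow \<Omega>"]) (use K_subset finite_points in auto)

lemma finite_S: "finite \<S>"
  by (rule finite_subset[of _ "Pow \<Omega>"]) (use S_subset finite_points in auto)

lemma finite_in_K: "K \<in> \<K> \<Longrightarrow> finite K"
  using K_subset finite_points finite_subset by blast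

lemma finite_in_S: "S \<in> \<S> \<Longrightarrow> finite S"
  using S_subset finite_points finite_subset by blast

lemma meet_unique:
  assumes "K \<in> \<K>" "S \<in> \<S>" "x \<in> K" "x \<in> S" "y \<in> K" "y \<in> S"
  shows "x = y"
  using transversal[OF assms(1,2)] assms(3-6) by auto

lemma separate_K:
  assumes "x \<in> \<Omega>" "y \<in> \<Omega>" "x \<noteq> y"
  obtains K where "K \<in> \<K>" "x \<in> K" "y \<notin> K"
proof -
  obtain K0 S0 where "K0 \<in> \<K>" "S0 \<in> \<S>" using K_ex S_ex by blast
  then have "K0 \<noteq> {}" using transversal by fastforce
  then show thesis
    using separating_member[OF K_subset G_K \<open>K0 \<in> \<K>\<close> _ K_proper[OF \<open>K0 \<in> \<K>\<close>] assms] that by metis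
qed

lemma separate_S:
  assumes "x \<in> \<Omega>" "y \<in> \<Omega>" "x \<noteq> y"
  obtains S where "S \<in> \<S>" "x \<in> S" "y \<notin> S"
proof -
  obtain K0 S0 where "K0 \<in> \<K>" "S0 \<in> \<S>" using K_ex S_ex by blast
  then have "S0 \<noteq> {}" using transversal by fastforce
  then show thesis
    using separating_member[OF S_subset G_image_S \<open>S0 \<in> \<S>\<close> _ S_proper[OF \<open>S0 \<in> \<S>\<close>] assms] that by metis
qed

lemma K_through:
  assumes "x \<in> \<Omega>"
  obtains K where "K \<in> \<K>" "x \<in> K"
proof -
  obtain K0 S0 where "K0 \<in> \<K>" "S0 \<in> \<S>" using K_ex S_ex by blast
  with transversal obtain z where z: "z \<in> K0" by blast
  then obtain g where "g \<in> G" "g z = x" using transitive K_subset \<open>K0 \<in> \<K>\<close> assms by blast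
  then show thesis using that[OF G_K[OF _ \<open>K0 \<in> \<K>\<close>]] z by blast
qed

text \<open>Double counting of incidences between \<open>\<K>\<close> and a member \<open>T\<close>
  of \<open>\<S>\<close>: each \<open>K\<close> meets \<open>T\<close> once, and by transitivity
  each point lies in the same number of members of \<open>\<K>\<close>. So \<open>card T\<close> is
  determined by \<open>\<K>\<close> alone.\<close>

lemma card_S_eq:
  assumes "S \<in> \<S>" "S' \<in> \<S>"
  shows "card S = card S'"
proof -
  obtain K0 where K0: "K0 \<in> \<K>" using K_ex by blast
  then obtain w where w: "w \<in> \<Omega>" "w \<in> K0" using transversal[OF K0 assms(1)] K_subset by blast
  let ?c = "card {K \<in> \<K>. w \<in> K}"
  have "?c > 0" using K0 w finite_K by (auto simp: card_gt_0_iff)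
  have *: "card \<K> = card T * ?c" if T: "T \<in> \<S>" for T
  proof -
    have 1: "card {x \<in> T. x \<in> K} = 1" if "K \<in> \<K>" for K
    proof -
      obtain z where "z \<in> K" "z \<in> T" using transversal[OF \<open>K \<in> \<K>\<close> T] by blast
      then have "{x \<in> T. x \<in> K} = {z}" using meet_unique[OF \<open>K \<in> \<K>\<close> T] by blast
      then show ?thesis by simp
    qed
    have "card T * ?c = (\<Sum>x\<in>T. card {K \<in> \<K>. x \<in> K})"
      using card_members_eq[OF K_subset G_K _ w(1)] S_subset[OF T] by (simp add: subset_iff)
    also have "\<dots> = (\<Sum>K\<in>\<K>. card {x \<in> T. x \<in> K})"
      using sum_multicount_gen[OF finite_in_S[OF T] finite_K, of "\<lambda>x K. x \<in> K"
          "\<lambda>K. card {x \<in> T. x \<in> K}"] by simp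
    also have "\<dots> = card \<K>" using 1 by simp
    finally show ?thesis by simp
  qed
  show ?thesis using *[OF assms(1)] *[OF assms(2)] \<open>?c > 0\<close> by simp
qed

section \<open>Maps respecting both families, and exchanges of two points\<close>

definition endo :: "('a \<Rightarrow> 'a) \<Rightarrow> bool"
  where "endo h \<longleftrightarrow> h \<in> \<Omega> \<rightarrow> \<Omega> \<and> (\<forall>K\<in>\<K>. h ` K \<in> \<K>) \<and> (\<forall>S\<in>\<S>. h -` S \<inter> \<Omega> \<in> \<S>)"

lemma endo_compose_G:
  assumes "endo h" "g \<in> G"
  shows "endo (h \<circ> g)"
proof -
  have "(h \<circ> g) -` S \<inter> \<Omega> \<in> \<S>" if "S \<in> \<S>" for S
  proof -
    have "(h \<circ> g) -` S \<inter> \<Omega> = g -` (h -` S \<inter> \<Omega>) \<inter> \<Omega>"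
      using G_closed[OF assms(2)] by auto
    then show ?thesis using assms that G_S[OF assms(2)] by (simp only: endo_def)
  qed
  moreover have "(h \<circ> g) ` K \<in> \<K>" if "K \<in> \<K>" for K
    unfolding image_comp[symmetric] using assms that G_K by (simp add: endo_def)
  moreover have "h \<circ> g \<in> \<Omega> \<rightarrow> \<Omega>" using assms G_closed by (auto simp: endo_def)
  ultimately show ?thesis by (simp add: endo_def)
qed

text \<open>If preimages were injective on \<open>\<S>\<close>, every member of \<open>\<S>\<close> would be a union of fibres of \<open>h\<close>.\<close>

lemma preimage_collision:
  assumes h: "endo h" and xy: "x \<in> \<Omega>" "y \<in> \<Omega>" "x \<noteq> y" "h x = h y"
  obtains S S' where "S \<in> \<S>" "S' \<in> \<S>" "S \<noteq> S'" "h -` S \<inter> \<Omega> = h -` S' \<inter> \<Omega>"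
proof -
  let ?p = "\<lambda>S. h -` S \<inter> \<Omega>"
  have "\<not> inj_on ?p \<S>"
  proof
    assume "inj_on ?p \<S>"
    moreover have "?p ` \<S> \<subseteq> \<S>" using h by (auto simp: endo_def)
    ultimately have surj: "?p ` \<S> = \<S>" using finite_S by (simp add: endo_inj_surj)
    obtain S where "S \<in> \<S>" "x \<in> S" "y \<notin> S" using separate_S[OF xy(1-3)] .
    with surj obtain S' where "S = ?p S'" by blast
    with \<open>x \<in> S\<close> \<open>y \<notin> S\<close> xy show False by auto
  qed
  then show thesis using that by (auto simp: inj_on_def)
qed

text \<open>Join two points when some member of \<open>\<K>\<close> contains both. Then
  \<open>P \<union> N\<close> is a 4-cycle with \<open>P\<close> and \<open>N\<close> as its
  non-adjacent pairs: each of them lies inside one member of \<open>\<S>\<close>, and cross pairs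
  are joined by \<open>square_K_adjacent\<close>.\<close>

definition square :: "'a set \<Rightarrow> 'a set \<Rightarrow> bool"
  where "square P N \<longleftrightarrow> card P = 2 \<and> card N = 2 \<and>
    (\<exists>S\<in>\<S>. \<exists>S'\<in>\<S>. P = S - S' \<and> N = S' - S)"

text \<open>\<open>K\<close> meets \<open>S\<close> only at \<open>x\<close>, which is not in
  \<open>S'\<close>. Its point in \<open>S'\<close> therefore lies outside \<open>S\<close>, that
  is, in \<open>N\<close>.\<close>

lemma square_K:
  assumes "square P N" "K \<in> \<K>" "x \<in> K" "x \<in> P"
  obtains z where "K \<inter> N = {z}" "K \<inter> P = {x}"
proof -
  obtain S S' where S: "S \<in> \<S>" "S' \<in> \<S>" "P = S - S'" "N = S' - S"
    using assms(1) by (auto simp: square_def)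
  obtain z where z: "z \<in> K" "z \<in> S'" using transversal assms S by blast
  have "z \<notin> S" using meet_unique[OF assms(2) S(1) z(1) _ assms(3)] assms(4) S z by auto
  have "K \<inter> N = {z}" using z \<open>z \<notin> S\<close> S meet_unique[OF assms(2) S(2)] by auto
  moreover have "K \<inter> P = {x}" using assms(3,4) S meet_unique[OF assms(2) S(1)] by auto
  ultimately show thesis by (rule that)
qed

text \<open>Some \<open>K\<close> passes through \<open>x\<close> and avoids the other point
  \<open>w\<close> of \<open>N\<close>; by \<open>square_K\<close> it must still meet
  \<open>N\<close>, hence at \<open>z\<close>.\<close>

lemma square_K_adjacent:
  assumes "square P N" "x \<in> P" "z \<in> N"
  obtains K where "K \<in> \<K>" "K \<inter> P = {x}" "K \<inter> N = {z}"
proof -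
  have "P \<subseteq> \<Omega>" "N \<subseteq> \<Omega>" "card N = 2" "P \<inter> N = {}"
    using assms(1) S_subset by (auto simp: square_def)
  then obtain w where w: "N = {z, w}" "w \<noteq> z"
    using assms(3) by (metis card_2_iff insert_commute insert_iff singletonD)
  have "x \<noteq> w" using w assms \<open>P \<inter> N = {}\<close> by auto
  with w \<open>P \<subseteq> \<Omega>\<close> \<open>N \<subseteq> \<Omega>\<close> assms(2) obtain K where K: "K \<in> \<K>" "x \<in> K" "w \<notin> K"
    using separate_K[of x w] by auto
  obtain z' where "K \<inter> N = {z'}" "K \<inter> P = {x}" using square_K[OF assms(1) K(1,2) assms(2)] .
  moreover have "z' = z" using \<open>K \<inter> N = {z'}\<close> w K by auto
  ultimately show thesis using that K by blast
qed

lemma square_commute: "square P N \<Longrightarrow> square N P"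
  by (auto simp: square_def)

lemma square_finite: "square P N \<Longrightarrow> finite P \<and> finite N"
  by (metis card.infinite square_def zero_neq_numeral)

lemma square_disjoint: "square P N \<Longrightarrow> P \<inter> N = {}"
  by (auto simp: square_def)

lemma square_subset: "square P N \<Longrightarrow> P \<union> N \<subseteq> \<Omega>"
  using S_subset by (auto simp: square_def)

lemma square_cards: "square P N \<Longrightarrow> card P = 2" "square P N \<Longrightarrow> card N = 2"
  by (simp_all add: square_def)

lemma square_card: "square P N \<Longrightarrow> card (P \<union> N) = 4"
  by (simp add: card_Un_disjoint square_finite square_disjoint square_cards)

lemma square_image:
  assumes "square P N" "g \<in> G"
  shows "square (g ` P) (g ` N)"
proof -
  have inj: "inj_on g \<Omega>" using G_bij_betw[OF assms(2)] by (simp add: bij_betw_def)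
  obtain S S' where S: "S \<in> \<S>" "S' \<in> \<S>" "P = S - S'" "N = S' - S"
    using assms(1) by (auto simp: square_def)
  have "g ` P = g ` S - g ` S'" "g ` N = g ` S' - g ` S"
    using S inj S_subset by (simp_all add: inj_on_image_set_diff[OF inj] subset_iff)
  moreover have "card (g ` P) = card P" "card (g ` N) = card N"
    using square_subset[OF assms(1)] inj by (auto intro!: card_image inj_on_subset[OF inj])
  ultimately show ?thesis using assms S G_image_S[OF assms(2)] unfolding square_def by metis
qed

text \<open>
  A collision of preimages changes a member of \<open>\<S>\<close> only at points missed by \<open>h\<close>. Two members
  of \<open>\<S>\<close> have equal size and cannot differ by the exchange of a single point, because then
  the two exchanged points would lie in the same members of \<open>\<K>\<close>; so at least four points are missed.
\<close>

lemma missed_points_square: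
  assumes h: "endo h" and card: "card (h ` \<Omega>) < card \<Omega>" "card \<Omega> \<le> card (h ` \<Omega>) + 4"
  obtains P N where "square P N" "P \<union> N = \<Omega> - h ` \<Omega>" "card \<Omega> = card (h ` \<Omega>) + 4"
proof -
  have hO: "h ` \<Omega> \<subseteq> \<Omega>" using h by (auto simp: endo_def)
  have "\<not> inj_on h \<Omega>" using card(1) card_image by fastforce
  then obtain x y where "x \<in> \<Omega>" "y \<in> \<Omega>" "x \<noteq> y" "h x = h y" by (auto simp: inj_on_def)
  then obtain S S' where S: "S \<in> \<S>" "S' \<in> \<S>" "S \<noteq> S'" and eq: "h -` S \<inter> \<Omega> = h -` S' \<inter> \<Omega>"
    using preimage_collision[OF h] by blast
  let ?P = "S - S'" and ?N = "S' - S"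
  have fin: "finite S" "finite S'" using S finite_in_S by auto
  have sub: "?P \<union> ?N \<subseteq> \<Omega> - h ` \<Omega>" using eq S S_subset by blast
  have cm: "card (\<Omega> - h ` \<Omega>) = card \<Omega> - card (h ` \<Omega>)"
    using hO finite_points by (intro card_Diff_subset) (auto intro: finite_subset)
  have cPN: "card ?P = card ?N"
    using card_S_eq[OF S(1,2)] fin by (metis card_le_sym_Diff le_refl le_antisym)
  have cU: "card (?P \<union> ?N) = card ?P + card ?N" using fin by (intro card_Un_disjoint) auto
  have "card (?P \<union> ?N) \<le> 4"
    using card_mono[OF _ sub] cm card finite_points by simp
  then have le2: "card ?P \<le> 2" using cU cPN by simp
  have "card ?P \<noteq> 0"
  proof
    assume "card ?P = 0"
    then have "card ?N = 0" using cPN by simp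
    with \<open>card ?P = 0\<close> have "?P = {}" "?N = {}" using fin card_0_eq finite_Diff by blast+
    then show False using S(3) by blast
  qed
  moreover have "card ?P \<noteq> 1"
  proof
    assume "card ?P = 1"
    then obtain a b where ab: "?P = {a}" "?N = {b}" using cPN by (metis card_1_singletonE)
    then have "a \<in> \<Omega>" "b \<in> \<Omega>" "a \<noteq> b" using S_subset S by auto
    then obtain K where K: "K \<in> \<K>" "a \<in> K" "b \<notin> K" using separate_K by blast
    obtain z where z: "z \<in> K" "z \<in> S'" using transversal[OF K(1) S(2)] by blast
    have "z \<noteq> b" using z(1) K(3) by auto
    then have "z \<in> S" using z(2) ab(2) by (metis DiffI singletonD)
    moreover have "a \<in> S" "a \<notin> S'" using ab(1) by blast+
    ultimately have "z = a" using meet_unique[OF K(1) S(1) z(1) _ K(2)] by simp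
    then show False using z(2) \<open>a \<notin> S'\<close> by simp
  qed
  ultimately have "card ?P = 2" using le2 by simp
  then have sq: "square ?P ?N" using S cPN by (auto simp: square_def)
  have "card (\<Omega> - h ` \<Omega>) \<le> card (?P \<union> ?N)" using cm card cU cPN \<open>card ?P = 2\<close> by simp
  then have "?P \<union> ?N = \<Omega> - h ` \<Omega>" using sub finite_points by (intro card_seteq) auto
  moreover from this have "card (\<Omega> - h ` \<Omega>) = 4" using square_card[OF sq] by simp
  then have "card \<Omega> = card (h ` \<Omega>) + 4" using cm card(1) by linarith
  ultimately show thesis using that[OF sq] by blast
qed

section \<open>The span of the indicator functions over the field with three elements\<close>

text \<open>Closure under adding indicators already gives a subspace, because scalars of type
  \<open>3\<close> are repeated sums.\<close>

inductive_set \<V> :: "('a \<Rightarrow> 3) set"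
  where
    zero: "(\<lambda>_. 0) \<in> \<V>"
  | add: "S \<in> \<S> \<Longrightarrow> \<phi> \<in> \<V> \<Longrightarrow> (\<lambda>x. of_bool (x \<in> S) + \<phi> x) \<in> \<V>"

lemma V_ind: "S \<in> \<S> \<Longrightarrow> (\<lambda>x. of_bool (x \<in> S)) \<in> \<V>"
  using \<V>.add[OF _ \<V>.zero] by simp

lemma V_add: "\<phi> \<in> \<V> \<Longrightarrow> \<psi> \<in> \<V> \<Longrightarrow> (\<lambda>x. \<phi> x + \<psi> x) \<in> \<V>"
proof (induction rule: \<V>.induct)
  case (add S \<phi>)
  then show ?case using \<V>.add[OF add.hyps(1) add.IH[OF add.prems]] by (simp add: add.assoc)
qed simp

lemma V_scale:
  assumes "\<phi> \<in> \<V>"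
  shows "(\<lambda>x. c * \<phi> x) \<in> \<V>"
  using V_add[OF assms assms] assms \<V>.zero by (cases c rule: three_exhaust) simp_all

lemma V_diff:
  assumes "\<phi> \<in> \<V>" "\<psi> \<in> \<V>"
  shows "(\<lambda>x. \<phi> x - \<psi> x) \<in> \<V>"
  using V_add[OF assms(1) V_scale[OF assms(2), of "-1"]] by simp

lemma V_outside: "\<phi> \<in> \<V> \<Longrightarrow> x \<notin> \<Omega> \<Longrightarrow> \<phi> x = 0"
  by (induction rule: \<V>.induct) (use S_subset in auto)

lemma finite_V: "finite \<V>"
proof (rule finite_subset)
  show "\<V> \<subseteq> {\<phi>. (\<forall>x. x \<in> \<Omega> \<longrightarrow> \<phi> x \<in> UNIV) \<and> (\<forall>x. x \<notin> \<Omega> \<longrightarrow> \<phi> x = 0)}"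
    using V_outside by auto
  show "finite {\<phi>. (\<forall>x. x \<in> \<Omega> \<longrightarrow> \<phi> x \<in> (UNIV :: 3 set)) \<and> (\<forall>x. x \<notin> \<Omega> \<longrightarrow> \<phi> x = 0)}"
    using finite_set_of_finite_funs[OF finite_points, of "UNIV :: 3 set" 0] by simp
qed

text \<open>The value 0 off \<Omega> agrees with \<open>V_outside\<close>, so pulled back functions
  can lie in \<open>\<V>\<close>.\<close>

definition pull :: "('a \<Rightarrow> 'a) \<Rightarrow> ('a \<Rightarrow> 3) \<Rightarrow> 'a \<Rightarrow> 3"
  where "pull h \<phi> = (\<lambda>x. if x \<in> \<Omega> then \<phi> (h x) else 0)"

lemma V_pull:
  assumes "endo h" "\<phi> \<in> \<V>"
  shows "pull h \<phi> \<in> \<V>"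
  using assms(2)
proof (induction rule: \<V>.induct)
  case zero
  then show ?case using \<V>.zero by (simp add: pull_def)
next
  case (add S \<phi>)
  have "h -` S \<inter> \<Omega> \<in> \<S>" using assms add by (auto simp: endo_def)
  moreover have "pull h (\<lambda>x. of_bool (x \<in> S) + \<phi> x) =
      (\<lambda>x. of_bool (x \<in> h -` S \<inter> \<Omega>) + pull h \<phi> x)"
    by (auto simp: pull_def)
  ultimately show ?case using \<V>.add[OF _ add.IH] by (simp only:)
qed

text \<open>A member of \<open>\<K>\<close> contains exactly one point of each \<open>S\<close>, so
  every indicator sums to 1 over it; the rest is additivity.\<close>

lemma V_sum:
  assumes "\<phi> \<in> \<V>" "K \<in> \<K>" "K' \<in> \<K>"
  shows "sum \<phi> K = sum \<phi> K'"
proof -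
  have 1: "(\<Sum>x\<in>T. of_bool (x \<in> S) :: 3) = 1" if "T \<in> \<K>" "S \<in> \<S>" for S T
  proof -
    obtain z where z: "z \<in> T" "z \<in> S" using transversal[OF \<open>T \<in> \<K>\<close> \<open>S \<in> \<S>\<close>] by blast
    have "(\<Sum>x\<in>T. of_bool (x \<in> S) :: 3) = (\<Sum>x\<in>T. if x = z then 1 else 0)"
      using meet_unique[OF that] z by (intro sum.cong) auto
    also have "\<dots> = 1" using z finite_in_K[OF that(1)] by simp
    finally show ?thesis .
  qed
  show ?thesis using assms(1)
  proof (induction rule: \<V>.induct)
    case (add S \<phi>)
    then show ?case using 1[OF assms(2)] 1[OF assms(3)] by (simp add: sum.distrib)
  qed simp
qed

definition square_fun :: "'a set \<Rightarrow> 'a set \<Rightarrow> 'a \<Rightarrow> 3"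
  where "square_fun P N = (\<lambda>x. of_bool (x \<in> P) - of_bool (x \<in> N))"

lemma square_fun_V:
  assumes "square P N"
  shows "square_fun P N \<in> \<V>"
proof -
  obtain S S' where S: "S \<in> \<S>" "S' \<in> \<S>" "P = S - S'" "N = S' - S"
    using assms by (auto simp: square_def)
  then have "square_fun P N = (\<lambda>x. of_bool (x \<in> S) - of_bool (x \<in> S'))"
    by (auto simp: square_fun_def)
  then show ?thesis using V_diff[OF V_ind V_ind] S by simp
qed

text \<open>Such a \<open>\<phi>\<close> is supported on \<open>P \<union> N\<close>, and its sum
  over any \<open>K\<close> equals that over \<open>h\<close> applied to \<open>K\<close>, which is
  0. A member of \<open>\<K>\<close> meeting the square exactly in \<open>x\<close> and
  \<open>z\<close> then gives opposite values there, and all cross pairs together fix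
  \<open>\<phi>\<close> up to a scalar.\<close>

lemma pull_kernel:
  assumes h: "endo h" and sq: "square P N" and PN: "P \<union> N = \<Omega> - h ` \<Omega>"
    and \<phi>: "\<phi> \<in> \<V>" and pull: "\<And>x. x \<in> \<Omega> \<Longrightarrow> \<phi> (h x) = 0"
  obtains c where "\<phi> = (\<lambda>x. c * square_fun P N x)"
proof -
  have zero: "\<phi> x = 0" if "x \<notin> P \<union> N" for x
    using that PN pull V_outside[OF \<phi>, of x] by (cases "x \<in> \<Omega>") auto
  have sum0: "sum \<phi> K = 0" if K: "K \<in> \<K>" for K
  proof -
    have "sum \<phi> K = sum \<phi> (h ` K)" using h \<phi> K by (intro V_sum) (auto simp: endo_def)
    also have "\<dots> = 0" using K_subset[OF K] pull by (intro sum.neutral) auto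
    finally show ?thesis .
  qed
  have opp: "\<phi> x = - \<phi> z" if xz: "x \<in> P" "z \<in> N" for x z
  proof -
    obtain K where K: "K \<in> \<K>" "K \<inter> P = {x}" "K \<inter> N = {z}"
      using square_K_adjacent[OF sq xz] .
    have "x \<noteq> z" using square_disjoint[OF sq] xz by auto
    have "sum \<phi> K = sum \<phi> {x, z}"
      using K zero finite_in_K[OF K(1)] by (intro sum.mono_neutral_right) auto
    then have "\<phi> x + \<phi> z = 0" using sum0[OF K(1)] \<open>x \<noteq> z\<close> by simp
    then show ?thesis by (simp add: eq_neg_iff_add_eq_0)
  qed
  have "P \<noteq> {}" "N \<noteq> {}" using square_cards[OF sq] by auto
  then obtain p n where p: "p \<in> P" and n: "n \<in> N" by blast
  have "\<phi> x = \<phi> p * square_fun P N x" for x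
  proof -
    consider "x \<in> P" "x \<notin> N" | "x \<in> N" "x \<notin> P" | "x \<notin> P \<union> N"
      using square_disjoint[OF sq] by auto
    then show ?thesis
    proof cases
      case 1
      then show ?thesis using opp[OF 1(1) n] opp[OF p n] by (simp add: square_fun_def)
    next
      case 2
      then show ?thesis using opp[OF p 2(1)] by (simp add: square_fun_def)
    qed (simp add: square_fun_def zero)
  qed
  then show thesis using that by blast
qed

text \<open>By \<open>missed_points_square\<close>, 4 is the least possible positive defect of an
  \<open>endo\<close> map, so excluding these maps excludes all defects from 1 to 4.\<close>

definition folding :: "('a \<Rightarrow> 'a) \<Rightarrow> bool"
  where "folding h \<longleftrightarrow> endo h \<and> card \<Omega> = card (h ` \<Omega>) + 4"

lemma folding_square:
  assumes "folding h"
  obtains P N where "square P N" "P \<union> N = \<Omega> - h ` \<Omega>"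
  using missed_points_square[of h] assms by (auto simp: folding_def)

lemma folding_compose_G: "folding h \<Longrightarrow> g \<in> G \<Longrightarrow> folding (h \<circ> g)"
  by (simp add: folding_def endo_compose_G G_image image_comp[symmetric] del: o_apply)

text \<open>
  Pulling back along \<open>h\<close> has a one-dimensional kernel on \<open>\<V>\<close>, so its image has codimension one and
  equals the kernel of any nonzero functional \<open>\<phi> \<mapsto> \<phi> x - \<phi> y\<close> that vanishes on it.
\<close>

lemma pull_image:
  assumes h: "folding h" and xy: "x \<in> \<Omega>" "y \<in> \<Omega>" "x \<noteq> y" "h x = h y"
  shows "pull h ` \<V> = {\<phi> \<in> \<V>. \<phi> x = \<phi> y}"
proof -
  let ?V0 = "{\<phi> \<in> \<V>. \<phi> x = \<phi> y}"
  have endo: "endo h" using h by (simp add: folding_def)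
  obtain P N where sq: "square P N" "P \<union> N = \<Omega> - h ` \<Omega>" using folding_square[OF h] .
  obtain S where S: "S \<in> \<S>" "x \<in> S" "y \<notin> S" using separate_S[OF xy(1-3)] .
  have card3: "card (UNIV :: 3 set) = 3" by simp
  \<comment> \<open>Dimensions are compared through cardinalities. Adding the three multiples of an
    indicator that separates \<open>x\<close> from \<open>y\<close> gives three disjoint copies of
    \<open>?V0\<close> in \<open>\<V>\<close>.\<close>
  have "card ?V0 * 3 \<le> card \<V>"
  proof -
    let ?f = "\<lambda>(\<phi>, c). (\<lambda>z. \<phi> z + c * of_bool (z \<in> S)) :: 'a \<Rightarrow> 3"
    have "inj_on ?f (?V0 \<times> UNIV)"
    proof (rule inj_onI, clarify)
      fix \<phi> \<psi> :: "'a \<Rightarrow> 3" and c d :: 3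
      assume eq: "(\<lambda>z. \<phi> z + c * of_bool (z \<in> S)) = (\<lambda>z. \<psi> z + d * of_bool (z \<in> S))"
        and "\<phi> x = \<phi> y" "\<psi> x = \<psi> y"
      from fun_cong[OF eq, of x] fun_cong[OF eq, of y] S this(2,3) have "c = d" by simp
      moreover have "\<phi> z = \<psi> z" for z using fun_cong[OF eq, of z] \<open>c = d\<close> by simp
      ultimately show "\<phi> = \<psi> \<and> c = d" by auto
    qed
    moreover have "?f ` (?V0 \<times> UNIV) \<subseteq> \<V>"
      using V_add V_scale[OF V_ind[OF S(1)]] by auto
    ultimately have "card (?V0 \<times> (UNIV :: 3 set)) \<le> card \<V>" using finite_V by (rule card_inj_on_le)
    then show ?thesis by (simp add: card_cartesian_product)
  qed
  \<comment> \<open>Each \<open>\<phi>\<close> differs from the chosen preimage of its pullback by a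
    kernel element, one of three multiples of \<open>square_fun P N\<close>.\<close>
  moreover have "card \<V> \<le> card (pull h ` \<V>) * 3"
  proof -
    let ?s = "inv_into \<V> (pull h)"
    let ?f = "\<lambda>(\<psi>, c). (\<lambda>z. ?s \<psi> z + c * square_fun P N z)"
    have "\<V> \<subseteq> ?f ` (pull h ` \<V> \<times> UNIV)"
    proof
      fix \<phi> assume \<phi>: "\<phi> \<in> \<V>"
      let ?\<psi> = "pull h \<phi>"
      have s: "?s ?\<psi> \<in> \<V>" "pull h (?s ?\<psi>) = ?\<psi>"
        using \<phi> by (auto intro: inv_into_into f_inv_into_f[of _ "pull h" \<V>])
      have "\<phi> (h z) - ?s ?\<psi> (h z) = 0" if "z \<in> \<Omega>" for z
        using fun_cong[OF s(2), of z] that by (simp add: pull_def)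
      then obtain c where "(\<lambda>z. \<phi> z - ?s ?\<psi> z) = (\<lambda>z. c * square_fun P N z)"
        using pull_kernel[OF endo sq V_diff[OF \<phi> s(1)]] by blast
      then have "\<phi> z = ?s ?\<psi> z + c * square_fun P N z" for z
        by (metis add.commute diff_add_cancel)
      then have "\<phi> = ?f (?\<psi>, c)" by auto
      then show "\<phi> \<in> ?f ` (pull h ` \<V> \<times> UNIV)" using \<phi> by blast
    qed
    then have "card \<V> \<le> card (pull h ` \<V> \<times> (UNIV :: 3 set))"
      using finite_V by (intro surj_card_le) auto
    then show ?thesis by (simp add: card_cartesian_product)
  qed
  moreover have "pull h ` \<V> \<subseteq> ?V0" using V_pull[OF endo] xy by (auto simp: pull_def)
  ultimately show ?thesis using finite_V by (intro card_seteq) auto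
qed

text \<open>The image of \<open>\<V>\<close> under \<open>pull h\<close> depends only on
  \<open>h\<close>, while \<open>pull_image\<close> describes it through any collapsed pair. Hence
  all collapsed pairs impose the same condition on \<open>\<phi>\<close>.\<close>

lemma split_iff:
  assumes "folding h" "\<phi> \<in> \<V>" and "x \<in> \<Omega>" "y \<in> \<Omega>" "x \<noteq> y" "h x = h y"
    and "u \<in> \<Omega>" "v \<in> \<Omega>" "u \<noteq> v" "h u = h v"
  shows "\<phi> x = \<phi> y \<longleftrightarrow> \<phi> u = \<phi> v"
  using pull_image[OF assms(1,3-6)] pull_image[OF assms(1,7-10)] assms(2) by blast

section \<open>Maps of defect four\<close>

lemma split_members:
  assumes "folding h" "S \<in> \<S>" and "x \<in> \<Omega>" "y \<in> \<Omega>" "x \<noteq> y" "h x = h y"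
    and "u \<in> \<Omega>" "v \<in> \<Omega>" "u \<noteq> v" "h u = h v"
  shows "(x \<in> S \<longleftrightarrow> y \<in> S) \<longleftrightarrow> (u \<in> S \<longleftrightarrow> v \<in> S)"
  using split_iff[OF assms(1) V_ind[OF assms(2)] assms(3-10)] by (auto split: split_of_bool_asm)

text \<open>\<open>S\<close> separates one collapsed pair, hence all of them, so each nontrivial
  fibre has one point in \<open>S\<close> and one outside. Deleting the points of \<open>?A\<close>
  leaves one point per fibre, so \<open>card ?A\<close> is the defect 4.\<close>

lemma card_fibres:
  assumes h: "folding h" and S: "S \<in> \<S>" and xy: "x \<in> S" "y \<in> \<Omega>" "y \<notin> S" "h x = h y"
  shows "card (h ` {u \<in> S. \<exists>v\<in>\<Omega> - S. h u = h v}) = 4"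
proof -
  let ?A = "{u \<in> S. \<exists>v\<in>\<Omega> - S. h u = h v}"
  have x: "x \<in> \<Omega>" "x \<noteq> y" using S_subset[OF S] xy by auto
  have A: "?A \<subseteq> \<Omega>" using S_subset[OF S] by auto
  have split: "u \<in> S \<longleftrightarrow> v \<notin> S" if "u \<in> \<Omega>" "v \<in> \<Omega>" "u \<noteq> v" "h u = h v" for u v
    using split_members[OF h S x(1) xy(2) x(2) xy(4) that] xy by blast
  have injA: "inj_on h ?A" using split A by (auto simp: inj_on_def)
  have "inj_on h (\<Omega> - ?A)"
  proof (rule inj_onI, rule ccontr)
    fix u v assume uv: "u \<in> \<Omega> - ?A" "v \<in> \<Omega> - ?A" "h u = h v" "u \<noteq> v"
    then consider "u \<in> S" "v \<in> \<Omega> - S" | "v \<in> S" "u \<in> \<Omega> - S" using split by blast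
    then have "u \<in> ?A \<or> v \<in> ?A" using uv(3)[symmetric] uv(3) by cases blast+
    then show False using uv by blast
  qed
  moreover have "h ` (\<Omega> - ?A) = h ` \<Omega>"
  proof (intro subset_antisym subsetI)
    fix w assume "w \<in> h ` \<Omega>"
    then obtain u where u: "u \<in> \<Omega>" "w = h u" by blast
    show "w \<in> h ` (\<Omega> - ?A)"
    proof (cases "u \<in> ?A")
      case True
      then obtain v where "v \<in> \<Omega> - S" "h u = h v" by blast
      then show ?thesis using u by (intro image_eqI[of _ _ v]) auto
    qed (use u in blast)
  qed blast
  ultimately have "card (\<Omega> - ?A) = card (h ` \<Omega>)" using card_image by fastforce
  moreover have "card (\<Omega> - ?A) = card \<Omega> - card ?A" "card ?A \<le> card \<Omega>"
    using A finite_points by (auto intro!: card_Diff_subset card_mono intro: finite_subset)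
  ultimately have "card ?A = 4" using h unfolding folding_def by linarith
  then show ?thesis using card_image[OF injA] by simp
qed

text \<open>\<open>square_fun P N\<close> separates \<open>x\<close> from \<open>y\<close>, hence
  every collapsed pair, so each of the four nontrivial fibres meets the four points of the square.
  Each fibre then contains exactly one of them, and its partner lies outside the square.\<close>

lemma fibres_across_square:
  assumes h: "folding h" and xy: "x \<in> \<Omega>" "y \<in> \<Omega>" "x \<noteq> y" "h x = h y"
    and sq: "square P N" and P: "x \<in> P" "y \<notin> P" and z: "z \<in> P \<union> N"
  obtains w where "w \<in> \<Omega>" "w \<noteq> z" "h w = h z" "w \<notin> P \<union> N"
proof -
  let ?\<zeta> = "square_fun P N" and ?Z = "P \<union> N"
  have "?\<zeta> x \<noteq> ?\<zeta> y" using P square_disjoint[OF sq] by (auto simp: square_fun_def)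
  then have \<zeta>: "?\<zeta> u \<noteq> ?\<zeta> v" if "u \<in> \<Omega>" "v \<in> \<Omega>" "u \<noteq> v" "h u = h v" for u v
    using split_iff[OF h square_fun_V[OF sq] xy that] by simp
  obtain S where S: "S \<in> \<S>" "x \<in> S" "y \<notin> S" using separate_S[OF xy(1-3)] .
  let ?A = "{u \<in> S. \<exists>v\<in>\<Omega> - S. h u = h v}"
  have cA: "card (h ` ?A) = 4" using card_fibres[OF h S(1,2) xy(2) S(3) xy(4)] .
  have fin: "finite ?Z" using square_finite[OF sq] by simp
  have sub: "h ` ?A \<subseteq> h ` ?Z"
  proof clarify
    fix u v assume uv: "u \<in> S" "v \<in> \<Omega>" "v \<notin> S" "h u = h v"
    then have "?\<zeta> u \<noteq> ?\<zeta> v" using S_subset[OF S(1)] by (intro \<zeta>) auto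
    then have "u \<in> ?Z \<or> v \<in> ?Z" by (auto simp: square_fun_def)
    then show "h u \<in> h ` ?Z" using uv(4) by (metis imageI)
  qed
  have "card (h ` ?Z) \<le> 4" using card_image_le[OF fin, of h] square_card[OF sq] by simp
  then have eq: "h ` ?A = h ` ?Z" using cA sub fin by (intro card_seteq) auto
  then have inj: "inj_on h ?Z"
    using cA square_card[OF sq] fin by (intro eq_card_imp_inj_on) auto
  have "h z \<in> h ` ?A" using z eq by blast
  then obtain u v where uv: "u \<in> S" "v \<in> \<Omega>" "v \<notin> S" "h u = h v" "h z = h u" by auto
  obtain w where w: "w \<in> \<Omega>" "w \<noteq> z" "h w = h z"
    using uv S_subset[OF S(1)] by (cases "z = u") auto
  then have "w \<notin> ?Z" using inj z by (auto simp: inj_on_def)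
  with w that show thesis by blast
qed

text \<open>A combination of \<open>square_fun P N\<close> with an indicator that agrees at
  \<open>x\<close> and \<open>y\<close> agrees on every collapsed pair. Comparing a point of the
  square with its partner outside forces membership, because 1 and -1 are distinct in characteristic
  3.\<close>

lemma square_sides:
  assumes h: "folding h" and xy: "x \<in> \<Omega>" "y \<in> \<Omega>" "x \<noteq> y" "h x = h y"
    and sq: "square P N" and P: "x \<in> P" "y \<notin> P"
    and S: "S \<in> \<S>" "x \<in> S" "y \<notin> S" and T: "T \<in> \<S>" "y \<in> T" "x \<notin> T"
  shows "P \<subseteq> S" "N \<subseteq> T"
proof -
  let ?\<zeta> = "square_fun P N"
  note partner = fibres_across_square[OF h xy sq P]
  have ZO: "P \<union> N \<subseteq> \<Omega>" using square_subset[OF sq] .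
  have dj: "P \<inter> N = {}" using square_disjoint[OF sq] .
  \<comment> \<open>Otherwise \<open>y\<close> has a partner outside the square, giving a third
    point in the fibre of \<open>x\<close> and \<open>y\<close>; one set \<open>S\<close> cannot
    separate all pairs among three points.\<close>
  have "y \<notin> N"
  proof
    assume "y \<in> N"
    then obtain w where w: "w \<in> \<Omega>" "w \<noteq> y" "h w = h y" "w \<notin> P \<union> N" using partner by blast
    then have "w \<noteq> x" using P by auto
    then have "w \<in> S \<longleftrightarrow> x \<notin> S"
      using split_members[OF h S(1) xy w(1) xy(1)] S w(3) xy(4) by auto
    moreover have "w \<in> S \<longleftrightarrow> y \<notin> S"
      using split_members[OF h S(1) xy w(1) xy(2) w(2,3)] S by auto
    ultimately show False using S by blast
  qed
  then have \<zeta>xy: "?\<zeta> x = 1" "?\<zeta> y = 0" using P dj by (auto simp: square_fun_def)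
  show "P \<subseteq> S"
  proof
    fix z assume z: "z \<in> P"
    then obtain w where w: "w \<in> \<Omega>" "w \<noteq> z" "h w = h z" "w \<notin> P \<union> N" using partner by blast
    let ?\<phi> = "\<lambda>u. ?\<zeta> u - of_bool (u \<in> S)"
    have "?\<phi> x = ?\<phi> y" using \<zeta>xy S by simp
    then have "?\<phi> w = ?\<phi> z"
      using split_iff[OF h V_diff[OF square_fun_V[OF sq] V_ind[OF S(1)]] xy w(1) _ w(2,3)] z ZO
      by blast
    moreover have "?\<zeta> z = 1" "?\<zeta> w = 0" using z w dj by (auto simp: square_fun_def)
    ultimately show "z \<in> S" by (cases "w \<in> S"; cases "z \<in> S") simp_all
  qed
  show "N \<subseteq> T"
  proof
    fix z assume z: "z \<in> N"
    then obtain w where w: "w \<in> \<Omega>" "w \<noteq> z" "h w = h z" "w \<notin> P \<union> N" using partner by blast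
    \<comment> \<open>With the plus sign both values are 1: at \<open>x\<close> it comes from the
      square, at \<open>y\<close> from \<open>T\<close>.\<close>
    let ?\<phi> = "\<lambda>u. ?\<zeta> u + of_bool (u \<in> T)"
    have "?\<phi> x = ?\<phi> y" using \<zeta>xy T by simp
    then have "?\<phi> w = ?\<phi> z"
      using split_iff[OF h V_add[OF square_fun_V[OF sq] V_ind[OF T(1)]] xy w(1) _ w(2,3)] z ZO
      by blast
    moreover have "?\<zeta> z = -1" "?\<zeta> w = 0" using z w dj by (auto simp: square_fun_def)
    ultimately show "z \<in> T" by (cases "w \<in> T"; cases "z \<in> T") simp_all
  qed
qed

text \<open>Every \<open>K\<close> through \<open>x\<close> meets both \<open>N\<close> and
  \<open>N'\<close> by \<open>square_K\<close>, and it meets \<open>T\<close> only once, so it meets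
  their intersection. One such \<open>K\<close> gives a common point \<open>a\<close>, another one
  avoiding \<open>a\<close> gives a second, and both sets have size two.\<close>

lemma opposite_side_unique:
  assumes sq: "square P N" "square P' N'" and x: "x \<in> P" "x \<in> P'"
    and T: "T \<in> \<S>" "N \<subseteq> T" "N' \<subseteq> T"
  shows "N = N'"
proof -
  have xO: "x \<in> \<Omega>" using square_subset[OF sq(1)] x by auto
  have meet: "\<exists>a. a \<in> K \<and> a \<in> N \<and> a \<in> N'" if K: "K \<in> \<K>" "x \<in> K" for K
  proof -
    obtain a where "K \<inter> N = {a}" using square_K[OF sq(1) K x(1)] .
    then have a: "a \<in> K" "a \<in> N" by auto
    obtain b where "K \<inter> N' = {b}" using square_K[OF sq(2) K x(2)] .
    then have b: "b \<in> K" "b \<in> N'" by auto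
    have "a = b" using meet_unique[OF K(1) T(1) a(1) _ b(1)] a(2) b(2) T(2,3) by auto
    then show ?thesis using a b by auto
  qed
  obtain K where K: "K \<in> \<K>" "x \<in> K" using K_through[OF xO] .
  then obtain a where a: "a \<in> N" "a \<in> N'" using meet by blast
  then have "a \<in> \<Omega>" "x \<noteq> a" using square_subset[OF sq(1)] square_disjoint[OF sq(1)] x by auto
  then obtain L where L: "L \<in> \<K>" "x \<in> L" "a \<notin> L" using separate_K[OF xO] by blast
  then obtain b where b: "b \<in> L" "b \<in> N" "b \<in> N'" using meet by blast
  have two: "card {a, b} = 2" using b L by (auto simp: card_insert_if)
  have "{a, b} = N"
    using two a b square_finite[OF sq(1)] square_cards[OF sq(1)] by (intro card_subset_eq) simp_all
  moreover have "{a, b} = N'"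
    using two a b square_finite[OF sq(2)] square_cards[OF sq(2)] by (intro card_subset_eq) simp_all
  ultimately show ?thesis by simp
qed

section \<open>The invariant graph of collapsed pairs\<close>

definition folded :: "('a \<times> 'a) set"
  where "folded = {(x, y). x \<in> \<Omega> \<and> y \<in> \<Omega> \<and> x \<noteq> y \<and> (\<exists>h. folding h \<and> h x = h y)}"

text \<open>Take \<open>S\<close> and \<open>T\<close> separating \<open>x\<close> and
  \<open>y\<close> in both directions. By \<open>square_sides\<close>, \<open>T\<close> contains
  \<open>N\<close> and \<open>N'\<close> while \<open>S\<close> contains \<open>P\<close> and
  \<open>P'\<close>, so \<open>opposite_side_unique\<close> applies first at \<open>x\<close>, then
  at a point of the common set \<open>N\<close>.\<close>

lemma square_unique:
  assumes "(x, y) \<in> folded" and sq: "square P N" "square P' N'"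
    and x: "x \<in> P" "x \<in> P'" and y: "y \<notin> P" "y \<notin> P'"
  shows "P = P'" "N = N'"
proof -
  obtain h where h: "folding h" and xy: "x \<in> \<Omega>" "y \<in> \<Omega>" "x \<noteq> y" "h x = h y"
    using assms(1) by (auto simp: folded_def)
  obtain S where S: "S \<in> \<S>" "x \<in> S" "y \<notin> S" using separate_S[OF xy(1-3)] .
  obtain T where T: "T \<in> \<S>" "y \<in> T" "x \<notin> T" using separate_S xy(1-3) by metis
  note sides = square_sides[OF h xy sq(1) x(1) y(1) S T] square_sides[OF h xy sq(2) x(2) y(2) S T]
  show N: "N = N'" using opposite_side_unique[OF sq x T(1) sides(2,4)] .
  obtain z where "z \<in> N" using square_cards(2)[OF sq(1)] by fastforce
  then show "P = P'"
    using opposite_side_unique[OF square_commute[OF sq(1)] square_commute[OF sq(2)] _ _ S(1)]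
      sides(1,3) N by blast
qed

lemma folded_subset: "folded \<subseteq> \<Omega> \<times> \<Omega>"
  by (auto simp: folded_def)

lemma sym_folded: "sym folded"
  by (rule symI) (auto simp: folded_def eq_commute)

text \<open>If \<open>h\<close> collapses a pair, then \<open>h\<close> preceded by the inverse of
  \<open>g\<close> collapses its translate. The graph \<open>folded\<close> admits all
  \<open>folding\<close> maps, hence this one.\<close>

lemma preserves_folded: "preserves G folded"
  unfolding preserves_def
proof clarify
  fix g x y assume g: "g \<in> G" and "(x, y) \<in> folded"
  then obtain h where h: "folding h" and xy: "x \<in> \<Omega>" "y \<in> \<Omega>" "x \<noteq> y" "h x = h y"
    by (auto simp: folded_def)
  obtain k where k: "k \<in> G" "\<And>x. x \<in> \<Omega> \<Longrightarrow> k (g x) = x"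
    using G_inverse[OF g] by blast
  have "folding (h \<circ> k)" using folding_compose_G[OF h k(1)] .
  moreover have "(h \<circ> k) (g x) = (h \<circ> k) (g y)" using k xy by simp
  ultimately show "(g x, g y) \<in> folded"
    using G_closed[OF g] G_eq_iff[OF g] xy unfolding folded_def by blast
qed

text \<open>If \<open>x\<close> lay in the first part of only one square, the same would hold at
  every point by translation. The points of one square would then be closed under lying in a common
  square, so by primitivity they would be all of \<Omega>, which has more than four points.\<close>

lemma two_squares:
  assumes sq: "square P0 N0" and n: "card \<Omega> > 4" and x: "x \<in> \<Omega>"
  obtains P N P' N' where "square P N" "square P' N'" "x \<in> P" "x \<in> P'" "(P, N) \<noteq> (P', N')"
proof (rule ccontr)
  assume "\<not> thesis"
  note no = notE[OF this that]
  have unique: "P = P' \<and> N = N'"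
    if "square P N" "square P' N'" and u: "u \<in> P" "u \<in> P'" for u P N P' N'
  proof -
    have sub: "P \<subseteq> \<Omega>" "N \<subseteq> \<Omega>" "P' \<subseteq> \<Omega>" "N' \<subseteq> \<Omega>"
      using square_subset[OF that(1)] square_subset[OF that(2)] by auto
    then obtain g where g: "g \<in> G" "g u = x" using transitive u(1) x by blast
    have inj: "inj_on g \<Omega>" using G_bij_betw[OF g(1)] by (simp add: bij_betw_def)
    have "g ` P = g ` P' \<and> g ` N = g ` N'"
      using no[OF square_image[OF that(1) g(1)] square_image[OF that(2) g(1)]] u g(2) by blast
    then show ?thesis using inj_on_image_eq_iff[OF inj] sub by simp
  qed
  let ?r = "{(u, v). \<exists>P N. square P N \<and> u \<in> P \<union> N \<and> v \<in> P \<union> N}"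
  obtain a b where ab: "P0 = {a, b}" "a \<noteq> b" using square_cards(1)[OF sq] by (auto simp: card_2_iff)
  have "P0 \<union> N0 = \<Omega>"
  proof (rule closed_set_eq_all)
    show "?r \<subseteq> \<Omega> \<times> \<Omega>" using square_subset by blast
    show "sym ?r" by (auto simp: sym_def)
    show "preserves G ?r"
      unfolding preserves_def
    proof clarify
      fix g u v P N assume "g \<in> G" "square P N" "u \<in> P \<union> N" "v \<in> P \<union> N"
      then show "\<exists>P N. square P N \<and> g u \<in> P \<union> N \<and> g v \<in> P \<union> N"
        using square_image by (intro exI[of _ "g ` P"] exI[of _ "g ` N"]) auto
    qed
    show "(a, b) \<in> ?r" using sq ab by blast
    show "a \<noteq> b" by fact
    show "P0 \<union> N0 \<subseteq> \<Omega>" using square_subset[OF sq] .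
    show "a \<in> P0 \<union> N0" using ab by simp
    fix u v
    assume u: "u \<in> P0 \<union> N0" and uv: "(u, v) \<in> ?r"
    show "v \<in> P0 \<union> N0"
    proof -
      obtain P N where PN: "square P N" "u \<in> P \<union> N" "v \<in> P \<union> N" using uv by blast
      obtain P1 N1 where 1: "square P1 N1" "u \<in> P1" "P1 \<union> N1 = P \<union> N"
        using PN square_commute by (metis Un_iff Un_commute)
      obtain P2 N2 where 2: "square P2 N2" "u \<in> P2" "P2 \<union> N2 = P0 \<union> N0"
        using u sq square_commute by (metis Un_iff Un_commute)
      show ?thesis using unique[OF 1(1) 2(1) 1(2) 2(2)] 1(3) 2(3) PN(3) by simp
    qed
  qed
  then show False using square_card[OF sq] n by simp
qed

text \<open>The graph \<open>folded\<close> has degree at most two, and a path in it closes up after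
  four edges. Its components thus have at most four points, while primitivity makes it connected on
  more than four.\<close>

lemma no_folding: "\<not> folding f"
proof
  assume f: "folding f"
  obtain P0 N0 where sq: "square P0 N0" "P0 \<union> N0 = \<Omega> - f ` \<Omega>" using folding_square[OF f] .
  have "\<Omega> \<noteq> {}" using square_subset[OF sq(1)] square_cards(1)[OF sq(1)] by auto
  then have "card (f ` \<Omega>) > 0" using finite_points by (simp add: card_gt_0_iff)
  then have n: "card \<Omega> > 4" using f by (simp add: folding_def)
  note sqs = two_squares[OF sq(1) n]
  have pair: "P = {a, b}" if "square P N" "a \<in> P" "b \<in> P" "a \<noteq> b" for P N a b
    using square_cards(1)[OF that(1)] that(2-4) by (auto simp: card_2_iff)
  \<comment> \<open>A neighbour of \<open>x\<close> missed by both \<open>P\<close> and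
    \<open>P'\<close> would make the two squares equal.\<close>
  have nbr: "y \<in> P \<or> y \<in> P'"
    if "square P N" "square P' N'" "x \<in> P" "x \<in> P'" "(P, N) \<noteq> (P', N')" "(x, y) \<in> folded"
    for x y P N P' N'
    using square_unique[OF that(6) that(1-4)] that(5) by blast
  \<comment> \<open>Each of \<open>P\<close> and \<open>P'\<close> offers only one point besides
    \<open>x\<close>.\<close>
  have le2: "c = a \<or> c = b" if abc: "(x, a) \<in> folded" "(x, b) \<in> folded" "(x, c) \<in> folded" "a \<noteq> b"
    for x a b c
  proof -
    have x: "x \<in> \<Omega>" "x \<noteq> a" "x \<noteq> b" "x \<noteq> c" using abc by (auto simp: folded_def)
    obtain P N P' N' where s: "square P N" "square P' N'" "x \<in> P" "x \<in> P'" "(P, N) \<noteq> (P', N')"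
      using sqs[OF x(1)] .
    have "a \<in> P \<or> a \<in> P'" "b \<in> P \<or> b \<in> P'" "c \<in> P \<or> c \<in> P'" using nbr[OF s] abc by auto
    then show ?thesis using pair[OF s(1) s(3)] pair[OF s(2) s(4)] x abc(4) by blast
  qed
  \<comment> \<open>A map collapsing \<open>x\<close> and \<open>y\<close> also collapses
    \<open>y'\<close> with some \<open>z\<close> outside a square that has \<open>x\<close> and
    \<open>y'\<close> on one side. Both pairs are collapsed by the same map, so every
    \<open>S\<close> separates both or neither.\<close>
  have step: "\<exists>z. (y', z) \<in> folded \<and> z \<noteq> x \<and> (\<forall>S\<in>\<S>. (x \<in> S \<longleftrightarrow> y \<in> S) \<longleftrightarrow> (y' \<in> S \<longleftrightarrow> z \<in> S))"
    if yy: "(x, y) \<in> folded" "(x, y') \<in> folded" "y \<noteq> y'" for x y y'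
  proof -
    obtain h where h: "folding h" and xy: "x \<in> \<Omega>" "y \<in> \<Omega>" "x \<noteq> y" "h x = h y"
      using yy(1) by (auto simp: folded_def)
    have y': "y' \<in> \<Omega>" "x \<noteq> y'" using yy(2) by (auto simp: folded_def)
    obtain P N P' N' where s: "square P N" "square P' N'" "x \<in> P" "x \<in> P'" "(P, N) \<noteq> (P', N')"
      using sqs[OF xy(1)] .
    obtain Q M where Q: "square Q M" "x \<in> Q" "y' \<in> Q" using nbr[OF s yy(2)] s by blast
    then have "y \<notin> Q" using pair[OF Q y'(2)] xy(3) yy(3) by blast
    then obtain z where z: "z \<in> \<Omega>" "z \<noteq> y'" "h z = h y'" "z \<notin> Q \<union> M"
      using fibres_across_square[OF h xy Q(1,2)] Q(3) by blast
    have "(y', z) \<in> folded" using h z y' by (auto simp: folded_def)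
    moreover have "z \<noteq> x" using z Q by auto
    moreover have "(x \<in> S \<longleftrightarrow> y \<in> S) \<longleftrightarrow> (y' \<in> S \<longleftrightarrow> z \<in> S)" if "S \<in> \<S>" for S
      using split_members[OF h that xy y'(1) z(1) z(2)[symmetric] z(3)[symmetric]] .
    ultimately show ?thesis by blast
  qed
  have "\<not> inj_on f \<Omega>" using f card_image[of f \<Omega>] by (auto simp: folding_def)
  then obtain a b where ab: "(a, b) \<in> folded" using f by (auto simp: inj_on_def folded_def)
  have small: False if C: "C \<subseteq> \<Omega>" "x \<in> C" "\<And>u v. u \<in> C \<Longrightarrow> (u, v) \<in> folded \<Longrightarrow> v \<in> C" "card C \<le> 4"
    for C x
  proof -
    have "a \<noteq> b" using ab by (simp add: folded_def)
    then have "C = \<Omega>"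
      using closed_set_eq_all[OF folded_subset sym_folded preserves_folded ab _ C(1-3)] by simp
    then show False using C(4) n by simp
  qed
  have sym: "(v, u) \<in> folded" if "(u, v) \<in> folded" for u v using sym_folded that by (rule symD)
  show False
  proof (cases "\<exists>x y z. (x, y) \<in> folded \<and> (x, z) \<in> folded \<and> y \<noteq> z")
    case True
    then obtain a b c where abc: "(b, a) \<in> folded" "(b, c) \<in> folded" "a \<noteq> c" by blast
    obtain d where d: "(c, d) \<in> folded" "d \<noteq> b"
      "\<forall>S\<in>\<S>. (b \<in> S \<longleftrightarrow> a \<in> S) \<longleftrightarrow> (c \<in> S \<longleftrightarrow> d \<in> S)"
      using step[OF abc] by blast
    obtain e where e: "(d, e) \<in> folded" "e \<noteq> c"
      "\<forall>S\<in>\<S>. (c \<in> S \<longleftrightarrow> b \<in> S) \<longleftrightarrow> (d \<in> S \<longleftrightarrow> e \<in> S)"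
      using step[OF sym[OF abc(2)] d(1)] d(2) by blast
    have O: "a \<in> \<Omega>" "b \<in> \<Omega>" "c \<in> \<Omega>" "d \<in> \<Omega>" "e \<in> \<Omega>" using abc d e folded_subset by auto
    \<comment> \<open>Modulo 2, membership in any \<open>S\<close> satisfies a + b = c + d and b + c
      = d + e; adding gives a = e, and \<open>\<S>\<close> separates points.\<close>
    have "a = e"
    proof (rule ccontr)
      assume "a \<noteq> e"
      then obtain S where "S \<in> \<S>" "a \<in> S" "e \<notin> S" using separate_S O by blast
      then show False using d(3) e(3) by blast
    qed
    show False
    proof (rule small[of "{a, b, c, d}" a])
      show "card {a, b, c, d} \<le> 4" by (auto simp: card_insert_if)
      fix u v assume "u \<in> {a, b, c, d}" and uv: "(u, v) \<in> folded"
      then consider "u = a" | "u = b" | "u = c" | "u = d" by blast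
      then show "v \<in> {a, b, c, d}"
      proof cases
        case 1
        then show ?thesis using le2[OF sym[OF abc(1)] _ _ d(2)[symmetric], of v] sym[OF e(1)] uv \<open>a = e\<close>
          by auto
      next
        case 2
        then show ?thesis using le2[OF abc(1,2) _ abc(3), of v] uv by auto
      next
        case 3
        then show ?thesis using le2[OF sym[OF abc(2)] d(1) _ d(2)[symmetric], of v] uv by auto
      next
        case 4
        then show ?thesis using le2[OF sym[OF d(1)] e(1) _ e(2)[symmetric], of v] uv \<open>a = e\<close> by auto
      qed
    qed (use O in auto)
  next
    case False
    show False
    proof (rule small[of "{a, b}" a])
      show "card {a, b} \<le> 4" by (auto simp: card_insert_if)
      show "{a, b} \<subseteq> \<Omega>" using ab folded_subset by auto
      fix u v assume "u \<in> {a, b}" "(u, v) \<in> folded"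
      then show "v \<in> {a, b}" using False ab sym[OF ab] by blast
    qed simp
  qed
qed

lemma endo_defect:
  assumes "endo h" "card (h ` \<Omega>) < card \<Omega>"
  shows "card (h ` \<Omega>) + 4 < card \<Omega>"
proof (rule ccontr)
  assume "\<not> ?thesis"
  then have "folding h"
    using missed_points_square[OF assms] assms(1) by (auto simp: folding_def)
  then show False using no_folding by blast
qed

end

section \<open>Images and kernel classes of minimal rank\<close>

lemma (in primitive_permutations) synchronizes_if_small_defect:
  assumes f: "f \<in> \<Omega> \<rightarrow>\<^sub>E \<Omega>" and rank: "rank \<Omega> f < card \<Omega>" "card \<Omega> \<le> rank \<Omega> f + 4"
  shows "synchronizes \<Omega> G f"
proof (rule ccontr)
  assume ns: "\<not> synchronizes \<Omega> G f"
  let ?T = "transformation_semigroup \<Omega> (insert f G)"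
  have T_closed: "t \<in> \<Omega> \<rightarrow> \<Omega>" if "t \<in> ?T" for t
    using that
  proof (induction rule: transformation_semigroup.induct)
    case (generator t)
    then show ?case using f G_closed by auto
  next
    case (product s t)
    then show ?case by (auto simp: compose_def)
  qed
  have T_image: "compose \<Omega> s t ` A = s ` t ` A" if "A \<subseteq> \<Omega>" for s t :: "'a \<Rightarrow> 'a" and A
    using that by (force simp: compose_def)
  have fT: "f \<in> ?T" by (rule transformation_semigroup.generator) simp
  define r where "r = (LEAST k. \<exists>t\<in>?T. rank \<Omega> t = k)"
  have "\<exists>t\<in>?T. rank \<Omega> t = r"
    unfolding r_def by (rule LeastI[of _ "rank \<Omega> f"]) (use fT in blast)
  then obtain t0 where t0: "t0 \<in> ?T" "rank \<Omega> t0 = r" by blast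
  have r_le: "r \<le> rank \<Omega> t" if "t \<in> ?T" for t
    unfolding r_def by (rule Least_le) (use that in blast)
  have finite_image: "finite (t ` \<Omega>)" for t :: "'a \<Rightarrow> 'a" using finite_points by simp
  \<comment> \<open>By minimality of \<open>r\<close>, composing with \<open>t\<close> first cannot
    shrink the image of \<open>s\<close>.\<close>
  have left: "rank \<Omega> (compose \<Omega> s t) = r" "s ` t ` \<Omega> = s ` \<Omega>"
    if st: "s \<in> ?T" "t \<in> ?T" "rank \<Omega> s = r" for s t
  proof -
    have sub: "s ` t ` \<Omega> \<subseteq> s ` \<Omega>" using T_closed[OF st(2)] by auto
    have "r \<le> card (s ` t ` \<Omega>)"
      using r_le[OF transformation_semigroup.product[OF st(1,2)]] T_image by (simp add: rank_def)
    then show "s ` t ` \<Omega> = s ` \<Omega>"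
      using st(3) sub finite_image by (intro card_seteq) (auto simp: rank_def)
    then show "rank \<Omega> (compose \<Omega> s t) = r" using st(3) T_image by (simp add: rank_def)
  qed
  \<comment> \<open>By minimality of \<open>r\<close>, no map of the semigroup can identify points
    in an image of size \<open>r\<close>.\<close>
  have right: "rank \<Omega> (compose \<Omega> s t) = r" "inj_on s (t ` \<Omega>)"
    if st: "s \<in> ?T" "t \<in> ?T" "rank \<Omega> t = r" for s t
  proof -
    have "r \<le> card (s ` t ` \<Omega>)"
      using r_le[OF transformation_semigroup.product[OF st(1,2)]] T_image by (simp add: rank_def)
    then have eq: "card (s ` t ` \<Omega>) = card (t ` \<Omega>)"
      using card_image_le[OF finite_image, of s t] st(3) by (simp add: rank_def)
    then show "inj_on s (t ` \<Omega>)" using finite_image by (intro eq_card_imp_inj_on)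
    show "rank \<Omega> (compose \<Omega> s t) = r" using eq st(3) T_image by (simp add: rank_def)
  qed
  let ?K = "{t ` \<Omega> | t. t \<in> ?T \<and> rank \<Omega> t = r}"
  let ?S = "{t -` {c} \<inter> \<Omega> | t c. t \<in> ?T \<and> rank \<Omega> t = r \<and> c \<in> t ` \<Omega>}"
  have image_K: "u ` K \<in> ?K" if u: "u \<in> ?T" and K: "K \<in> ?K" for u K
  proof -
    obtain t where t: "K = t ` \<Omega>" "t \<in> ?T" "rank \<Omega> t = r" using K by blast
    have "u ` K = compose \<Omega> u t ` \<Omega>" using T_image t(1) by simp
    then show ?thesis
      using right(1)[OF u t(2,3)] transformation_semigroup.product[OF u t(2)] by blast
  qed
  have preimage_S: "u -` S \<inter> \<Omega> \<in> ?S" if u: "u \<in> ?T" and S: "S \<in> ?S" for u S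
  proof -
    obtain t c where t: "S = t -` {c} \<inter> \<Omega>" "t \<in> ?T" "rank \<Omega> t = r" "c \<in> t ` \<Omega>" using S by blast
    have "u -` S \<inter> \<Omega> = compose \<Omega> t u -` {c} \<inter> \<Omega>"
      using t(1) T_closed[OF u] by (auto simp: compose_def)
    moreover have "c \<in> compose \<Omega> t u ` \<Omega>" using left(2)[OF t(2) u t(3)] t(4) T_image by simp
    ultimately show ?thesis
      using left(1)[OF t(2) u t(3)] transformation_semigroup.product[OF t(2) u] by blast
  qed
  have GT: "g \<in> ?T" if "g \<in> G" for g using that by (intro transformation_semigroup.generator) simp
  interpret transversal_families \<Omega> G ?K ?S
  proof unfold_locales
    show "K \<subseteq> \<Omega>" if "K \<in> ?K" for K using that T_closed by blast
    show "S \<subseteq> \<Omega>" if "S \<in> ?S" for S using that by blast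
    show "K \<noteq> \<Omega>" if "K \<in> ?K" for K
    proof -
      have "card K < card \<Omega>" using that r_le[OF fT] rank(1) by (auto simp: rank_def)
      then show ?thesis by auto
    qed
    \<comment> \<open>A kernel class equal to \<Omega> would come from a constant map; failure of
      synchronization enters here.\<close>
    show "S \<noteq> \<Omega>" if S: "S \<in> ?S" for S
    proof
      assume "S = \<Omega>"
      then obtain t c where t: "t \<in> ?T" "c \<in> t ` \<Omega>" "t -` {c} \<inter> \<Omega> = \<Omega>"
        using S by blast
      then have "\<forall>x\<in>\<Omega>. t x = c" by blast
      moreover have "c \<in> \<Omega>" using t(2) T_closed[OF t(1)] by auto
      ultimately have "constant_map \<Omega> t" by (auto simp: constant_map_def)
      then show False using ns t(1) by (auto simp: synchronizes_def)
    qed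
    show "?K \<noteq> {}" using t0 by blast
    have "\<Omega> \<noteq> {}" using rank(1) by auto
    then show "?S \<noteq> {}" using t0 by blast
    show "\<exists>!x. x \<in> K \<and> x \<in> S" if K: "K \<in> ?K" and S: "S \<in> ?S" for K S
    proof -
      obtain t where t: "K = t ` \<Omega>" "t \<in> ?T" "rank \<Omega> t = r" using K by blast
      obtain s c where s: "S = s -` {c} \<inter> \<Omega>" "s \<in> ?T" "rank \<Omega> s = r" "c \<in> s ` \<Omega>"
        using S by blast
      \<comment> \<open>The fact \<open>left\<close> makes \<open>s\<close> map \<open>K\<close>
        onto its whole image, so \<open>K\<close> meets the kernel class over \<open>c\<close>;
        injectivity from \<open>right\<close> makes the point unique.\<close>
      have "c \<in> s ` K" using left(2)[OF s(2) t(2) s(3)] s(4) t(1) by simp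
      moreover have "inj_on s K" using right(2)[OF s(2) t(2,3)] t(1) by simp
      moreover have "K \<subseteq> \<Omega>" using t(1) T_closed[OF t(2)] by auto
      ultimately show ?thesis using s(1) by (auto simp: inj_on_def)
    qed
    show "g ` K \<in> ?K" if "g \<in> G" "K \<in> ?K" for g K using image_K GT that by blast
    show "g -` S \<inter> \<Omega> \<in> ?S" if "g \<in> G" "S \<in> ?S" for g S using preimage_S[OF GT] that by blast
  qed
  have "endo f" using T_closed[OF fT] image_K[OF fT] preimage_S[OF fT] unfolding endo_def by blast
  then show False using endo_defect[of f] rank by (simp add: rank_def)
qed

text \<open>Ranks are compared in \<open>int\<close>, since natural subtraction would truncate for
  small \<open>n\<close>. Both cases are defects between 1 and 4.\<close>

theorem theorem1p2:
  fixes \<Omega> :: "'a set" and G :: "('a \<Rightarrow> 'a) set" and f :: "'a \<Rightarrow> 'a" and n :: nat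
  assumes "finite \<Omega>" and "card \<Omega> = n"
    and "primitive_group \<Omega> G"
    and "f \<in> \<Omega> \<rightarrow>\<^sub>E \<Omega>"
    and "int (rank \<Omega> f) = int n - 3 \<or> int (rank \<Omega> f) = int n - 4"
  shows "synchronizes \<Omega> G f"
proof -
  interpret primitive_permutations \<Omega> G
    by unfold_locales fact+
  show ?thesis
    using synchronizes_if_small_defect[OF assms(4)] assms(2,5) by linarith
qed

end
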